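(* Let $N\in\{1,2,\ldots\}$ and let $\Phi$ be a block tridiagonal quantum Markov chain on $V=\mathbb{Z}_{\ge 0}$ with internal space $\mathbb{C}^N$ and matrix representation $$\Phi=\begin{bmatrix} B_0 & C_1 & & \\ A_0 & B_1 & C_2 & \\ & A_1 & B_2 & C_3 \\ & & \ddots & \ddots & \ddots\end{bmatrix},\qquad A_n,B_n,C_{n+1}\in M_{N^2}(\mathbb{C}),\ n\ge 0,$$ and let $Q_n(x)$, $n\ge 0$, be the associated matrix-valued polynomials. Assume there is a weight matrix $W$ on $\mathbb{R}$, of size $N^2\times N^2$, such that for all $i,j,n\ge 0$ the $(i,j)$ block of $\Phi^n$ is $$\Phi^{(n)}_{ij}=\Pi_i\int_{\mathbb{R}}x^n Q_i^*(x)\,dW(x)\,Q_j(x),\qquad \Pi_i=\Big(\int_{\mathbb{R}}Q_i^*(x)\,dW(x)\,Q_i(x)\Big)^{-1}.$$ Let $\rho\in M_N(\mathbb{C})$ be a density matrix. Then a vertex $i\in V$ is $\rho$-recurrent if and only if $$\lim_{s\uparrow 1}\mathrm{Tr}\Big[\mathrm{vec}^{-1}\Big(\Pi_i\int_{\mathbb{R}}\frac{1}{1-sx}\,Q_i^*(x)\,dW(x)\,Q_i(x)\,\mathrm{vec}(\rho)\Big)\Big]=\infty .$$ As a consequence, vertex $0$ is $\rho$-recurrent if and only if $$\lim_{z\downarrow 1}\mathrm{Tr}\Big[\mathrm{vec}^{-1}\big(B(z;W)\,\mathrm{vec}(\rho)\big)\Big]=\infty ,$$ where $B(z;W)=\int_{\mathbb{R}}\frac{dW(x)}{z-x}$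 is the Stieltjes transform of $W$.
   Context: A quantum Markov chain (QMC) on a vertex set $V$ with internal space $\mathbb{C}^N$ is a block matrix $\Phi=(\Phi_{ij})_{i,j\in V}$ of completely positive maps $\Phi_{ij}$ on $M_N(\mathbb{C})$ such that each column sum $\sum_{i\in V}\Phi_{ij}$ is trace-preserving. It acts on columns $(\rho_j)_{j\in V}$, $\rho_j\in M_N(\mathbb{C})$, by $\Phi(\rho)_i=\sum_j\Phi_{ij}(\rho_j)$. For $A\in M_N(\mathbb{C})$, $\mathrm{vec}(A)\in\mathbb{C}^{N^2}$ is obtained by stacking the rows of $A$. The matrix representation replaces each $\Phi_{ij}$ by the $N^2\times N^2$ matrix $M$ with $\mathrm{vec}(\Phi_{ij}(X))=M\,\mathrm{vec}(X)$ and is denoted by the same letter; $A_n,B_n,C_n$ are the blocks in positions $(n+1,n)$, $(n,n)$, $(n-1,n)$. A density matrix is a positive semidefinite matrix of trace 1. $\Phi^{(n)}_{ij}$ is the $(i,j)$ block of $\Phi^n$. For a density matrix $\rho$, $p_{ji;\rho}(n)=\mathrm{Tr}(\mathrm{vec}^{-1}[\Phi^{(n)}_{ji}\mathrm{vec}(\rho)])$ is the probability of being at $j$ after $n$ steps, starting at $i$ with internal state $\rho$. Vertex $i$ is $\rho$-recurrent if $\sum_{n=0}^\infty p_{ii;\rho}(n)=\infty$. The matrix-valued polynomials associated with $\Phi$ are given by $Q_0(x)=I$, $Q_{-1}(x)=0$ and $xQ_n(x)=Q_{n+1}(x)A_n+Q_n(x)B_n+Q_{n-1}(x)C_n$, $n\ge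 0$ (the $A_n$ being nonsingular). A weight matrix is a square matrix of measures supported on the real line (discrete measures allowed) which is positive semidefinite, i.e. $W(y)-W(x)$ is positive semidefinite for $x<y$ when $W$ is viewed as a matrix-valued distribution function.
   Formalization: The criterion for vertex 0 is proved with Π_0 B(z;W) in place of B(z;W), and with B(z;W) alone only when Π_0 = I; without this normalization of W the displayed criterion can fail. *)

theory Defs
  imports "HOL-Analysis.Analysis"
begin

section \<open>Complex matrices\<close>

type_synonym 'm cmat = "complex ^ 'm ^ 'm"

definition adj :: "'m::finite cmat \<Rightarrow> 'm cmat" where
  "adj M = (\<chi> i j. cnj (M $ j $ i))"

definition cinner :: "complex ^ 'm::finite \<Rightarrow> complex ^ 'm \<Rightarrow> complex" where
  "cinner u v = (\<Sum>i\<in>UNIV. cnj (u $ i) * v $ i)"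

definition psd :: "'m::finite cmat \<Rightarrow> bool" where
  "psd M \<longleftrightarrow> adj M = M \<and> (\<forall>v. 0 \<le> Re (cinner v (M *v v)))"

definition density_matrix :: "'m::finite cmat \<Rightarrow> bool" where
  "density_matrix \<rho> \<longleftrightarrow> psd \<rho> \<and> trace \<rho> = 1"

text \<open>
  The \<open>N\<^sup>2\<close> coordinates of the vectorisation are indexed by pairs \<open>(row, column)\<close>. Stacking rows
  amounts to listing these pairs lexicographically; nothing below depends on a linear order.
\<close>

definition mvec :: "'n::finite cmat \<Rightarrow> complex ^ ('n \<times> 'n)" where
  "mvec A = (\<chi> p. A $ fst p $ snd p)"

definition unvec :: "complex ^ ('n::finite \<times> 'n) \<Rightarrow> 'n cmat" where
  "unvec v = (\<chi> i j. v $ (i, j))"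

lemma unvec_mvec [simp]: "unvec (mvec A) = A"
  by (simp add: unvec_def mvec_def vec_eq_iff)

lemma mvec_unvec [simp]: "mvec (unvec v) = v"
  by (simp add: unvec_def mvec_def vec_eq_iff)


section \<open>Quantum Markov chains\<close>

definition clinear_map :: "('n::finite cmat \<Rightarrow> 'n cmat) \<Rightarrow> bool" where
  "clinear_map F \<longleftrightarrow> (\<forall>X Y. F (X + Y) = F X + F Y) \<and>
     (\<forall>c X. F (\<chi> i. c *s X $ i) = (\<chi> i. c *s F X $ i))"

text \<open>Positive semidefiniteness of the \<open>m \<times> m\<close> block matrix \<open>(X a b)\<close>, \<open>a, b < m\<close>.\<close>

definition block_psd :: "nat \<Rightarrow> (nat \<Rightarrow> nat \<Rightarrow> 'n::finite cmat) \<Rightarrow> bool" where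
  "block_psd m X \<longleftrightarrow> (\<forall>a<m. \<forall>b<m. adj (X a b) = X b a) \<and>
     (\<forall>v. 0 \<le> Re (\<Sum>a<m. \<Sum>b<m. cinner (v a) (X a b *v v b)))"

definition completely_positive :: "('n::finite cmat \<Rightarrow> 'n cmat) \<Rightarrow> bool" where
  "completely_positive F \<longleftrightarrow> clinear_map F \<and>
     (\<forall>m X. block_psd m X \<longrightarrow> block_psd m (\<lambda>a b. F (X a b)))"

definition quantum_markov_chain :: "('v \<Rightarrow> 'v \<Rightarrow> 'n::finite cmat \<Rightarrow> 'n cmat) \<Rightarrow> bool" where
  "quantum_markov_chain \<Phi> \<longleftrightarrow> (\<forall>i j. completely_positive (\<Phi> i j)) \<and>
     (\<forall>j X. (\<lambda>i. \<Phi> i j X) summable_on UNIV \<and> trace (\<Sum>\<^sub>\<infinity>i. \<Phi> i j X) = trace X)"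

definition matrix_rep :: "('n::finite cmat \<Rightarrow> 'n cmat) \<Rightarrow> ('n \<times> 'n) cmat" where
  "matrix_rep F = matrix (\<lambda>v. mvec (F (unvec v)))"

lemma matrix_rep_works:
  assumes "clinear_map F"
  shows "mvec (F X) = matrix_rep F *v mvec X"
proof -
  have add: "F (X + Y) = F X + F Y" and scale: "F (\<chi> i. c *s X $ i) = (\<chi> i. c *s F X $ i)"
    for c X Y
    using assms by (auto simp: clinear_map_def)
  have "Vector_Spaces.linear (*s) (*s) (\<lambda>v. mvec (F (unvec v)))"
  proof (unfold_locales, goal_cases)
    case (1 v w)
    have "unvec (v + w) = unvec v + unvec w"
      by (simp add: unvec_def vec_eq_iff)
    then show ?case
      by (simp add: add) (simp add: mvec_def vec_eq_iff)
  next
    case (2 c v)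
    have "unvec (c *s v) = (\<chi> i. c *s unvec v $ i)"
      by (simp add: unvec_def vec_eq_iff)
    then show ?case
      by (simp add: scale) (simp add: mvec_def vec_eq_iff)
  qed
  from matrix_works[OF this, of "mvec X"] show ?thesis
    by (simp add: matrix_rep_def)
qed

text \<open>
  The \<open>(i, j)\<close> block of the \<open>n\<close>-th power of a block matrix. For block tridiagonal matrices the
  sum over \<open>k\<close> has at most three nonzero terms.
\<close>

primrec block_power :: "('v \<Rightarrow> 'v \<Rightarrow> 'm::finite cmat) \<Rightarrow> nat \<Rightarrow> 'v \<Rightarrow> 'v \<Rightarrow> 'm cmat" where
  "block_power M 0 i j = (if i = j then mat 1 else 0)"
| "block_power M (Suc n) i j = (\<Sum>\<^sub>\<infinity>k. M i k ** block_power M n k j)"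

definition qmc_power ::
    "('v \<Rightarrow> 'v \<Rightarrow> 'n::finite cmat \<Rightarrow> 'n cmat) \<Rightarrow> nat \<Rightarrow> 'v \<Rightarrow> 'v \<Rightarrow> ('n \<times> 'n) cmat" where
  "qmc_power \<Phi> = block_power (\<lambda>i j. matrix_rep (\<Phi> i j))"

text \<open>
  Probability of being at \<open>j\<close> after \<open>n\<close> steps, starting at \<open>i\<close> with internal state \<open>\<rho>\<close>. The trace
  is real when \<open>\<rho>\<close> is a density matrix, since all maps involved are completely positive.
\<close>

definition transition_prob ::
    "('v \<Rightarrow> 'v \<Rightarrow> 'n::finite cmat \<Rightarrow> 'n cmat) \<Rightarrow> 'n cmat \<Rightarrow> 'v \<Rightarrow> 'v \<Rightarrow> nat \<Rightarrow> real" where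
  "transition_prob \<Phi> \<rho> j i n = Re (trace (unvec (qmc_power \<Phi> n j i *v mvec \<rho>)))"

definition rho_recurrent ::
    "('v \<Rightarrow> 'v \<Rightarrow> 'n::finite cmat \<Rightarrow> 'n cmat) \<Rightarrow> 'n cmat \<Rightarrow> 'v \<Rightarrow> bool" where
  "rho_recurrent \<Phi> \<rho> i \<longleftrightarrow>
     filterlim (\<lambda>m. \<Sum>n<m. transition_prob \<Phi> \<rho> i i n) at_top sequentially"


section \<open>Weight matrices and integration\<close>

definition complex_measure :: "(real set \<Rightarrow> complex) \<Rightarrow> bool" where
  "complex_measure \<nu> \<longleftrightarrow>
     (\<forall>E :: nat \<Rightarrow> real set. range E \<subseteq> sets borel \<longrightarrow> disjoint_family E \<longrightarrow>
        (\<lambda>i. \<nu> (E i)) sums \<nu> (\<Union>i. E i))"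

text \<open>
  The positive part in the Jordan decomposition of a signed measure. The supremum is taken in
  \<open>ennreal\<close>, where \<open>ennreal\<close> sends negative reals to \<open>0\<close>; this is harmless because \<open>F = {}\<close>
  contributes \<open>0\<close> anyway.
\<close>

definition jordan_pos :: "(real set \<Rightarrow> real) \<Rightarrow> real measure" where
  "jordan_pos \<nu> = measure_of UNIV (sets borel)
     (\<lambda>E. SUP F \<in> {F \<in> sets borel. F \<subseteq> E}. ennreal (\<nu> F))"

definition cm_integrable :: "(real set \<Rightarrow> complex) \<Rightarrow> (real \<Rightarrow> complex) \<Rightarrow> bool" where
  "cm_integrable \<nu> f \<longleftrightarrow>
     integrable (jordan_pos (\<lambda>E. Re (\<nu> E))) f \<and> integrable (jordan_pos (\<lambda>E. - Re (\<nu> E))) f \<and>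
     integrable (jordan_pos (\<lambda>E. Im (\<nu> E))) f \<and> integrable (jordan_pos (\<lambda>E. - Im (\<nu> E))) f"

definition cm_integral :: "(real set \<Rightarrow> complex) \<Rightarrow> (real \<Rightarrow> complex) \<Rightarrow> complex" where
  "cm_integral \<nu> f =
     (integral\<^sup>L (jordan_pos (\<lambda>E. Re (\<nu> E))) f - integral\<^sup>L (jordan_pos (\<lambda>E. - Re (\<nu> E))) f) +
     \<i> * (integral\<^sup>L (jordan_pos (\<lambda>E. Im (\<nu> E))) f - integral\<^sup>L (jordan_pos (\<lambda>E. - Im (\<nu> E))) f)"

text \<open>
  \<open>W\<close> is a matrix of complex Borel measures on the real line; \<open>\<lambda>x. W {..x}\<close> is the associated
  matrix-valued distribution function.
\<close>

definition weight_matrix :: "(real set \<Rightarrow> 'm::finite cmat) \<Rightarrow> bool" where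
  "weight_matrix W \<longleftrightarrow>
     (\<forall>k l. complex_measure (\<lambda>E. W E $ k $ l)) \<and> (\<forall>x y. x < y \<longrightarrow> psd (W {..y} - W {..x}))"

text \<open>The matrix integral of \<open>F dW G\<close>, where the order of the factors matters.\<close>

definition weight_integrable ::
    "(real \<Rightarrow> 'm::finite cmat) \<Rightarrow> (real set \<Rightarrow> 'm cmat) \<Rightarrow> (real \<Rightarrow> 'm cmat) \<Rightarrow> bool" where
  "weight_integrable F W G \<longleftrightarrow>
     (\<forall>a k l b. cm_integrable (\<lambda>E. W E $ k $ l) (\<lambda>x. F x $ a $ k * G x $ l $ b))"

definition weight_integral ::
    "(real \<Rightarrow> 'm::finite cmat) \<Rightarrow> (real set \<Rightarrow> 'm cmat) \<Rightarrow> (real \<Rightarrow> 'm cmat) \<Rightarrow> 'm cmat" where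
  "weight_integral F W G =
     (\<chi> a b. \<Sum>k\<in>UNIV. \<Sum>l\<in>UNIV. cm_integral (\<lambda>E. W E $ k $ l) (\<lambda>x. F x $ a $ k * G x $ l $ b))"

definition stieltjes_transform :: "complex \<Rightarrow> (real set \<Rightarrow> 'm::finite cmat) \<Rightarrow> 'm cmat" where
  "stieltjes_transform z W =
     (\<chi> k l. cm_integral (\<lambda>E. W E $ k $ l) (\<lambda>x. 1 / (z - complex_of_real x)))"


section \<open>Associated polynomials\<close>

text \<open>
  The case distinction encodes \<open>Q\<^sub>-\<^sub>1 = 0\<close>. When all \<open>A n\<close> are invertible these equations determine
  \<open>Q\<close> uniquely, and every entry of \<open>Q n\<close> is a polynomial.
\<close>

definition associated_polynomials ::
    "(nat \<Rightarrow> 'm::finite cmat) \<Rightarrow> (nat \<Rightarrow> 'm cmat) \<Rightarrow> (nat \<Rightarrow> 'm cmat) \<Rightarrow>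
     (nat \<Rightarrow> real \<Rightarrow> 'm cmat) \<Rightarrow> bool" where
  "associated_polynomials A B C Q \<longleftrightarrow>
     (\<forall>x. Q 0 x = mat 1) \<and>
     (\<forall>n x. x *\<^sub>R Q n x =
        Q (Suc n) x ** A n + Q n x ** B n + (if n = 0 then 0 else Q (n - 1) x ** C n))"

definition norm_matrix ::
    "(real set \<Rightarrow> 'm::finite cmat) \<Rightarrow> (nat \<Rightarrow> real \<Rightarrow> 'm cmat) \<Rightarrow> nat \<Rightarrow> 'm cmat" where
  "norm_matrix W Q i = matrix_inv (weight_integral (\<lambda>x. adj (Q i x)) W (Q i))"

text \<open>
  For a complex-valued function, having limit \<open>\<infinity>\<close> means being eventually real and tending to
  \<open>+\<infinity>\<close>.
\<close>

definition tends_to_infinity :: "('a \<Rightarrow> complex) \<Rightarrow> 'a filter \<Rightarrow> bool" where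
  "tends_to_infinity f G \<longleftrightarrow> (\<forall>\<^sub>F s in G. f s \<in> \<real>) \<and> filterlim (\<lambda>s. Re (f s)) at_top G"

end

theory Submission
  imports Defs
begin

text \<open>
  The powers of a quantum Markov chain are positive and do not increase the trace, so the entries of
  all \<open>\<Phi>\<^sup>n\<close> are uniformly bounded (expand a matrix unit into four rank-one positive matrices by
  polarisation). Hence the moments of the diagonal entries of \<open>W\<close>, which are positive measures, are
  bounded, and Markov's inequality forces these measures to live on \<open>[-1, 1]\<close>; positivity of \<open>W\<close>
  carries this over to the off-diagonal entries. For \<open>0 < s < 1\<close> one may therefore expand
  \<open>1 / (1 - s x)\<close> geometrically under the integral, and the function of \<open>s\<close> in the theorem is the
  generating function of the nonnegative numbers \<open>p\<^sub>n\<close>. It tends to \<open>\<infinity>\<close> as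
  \<open>s\<close> increases to \<open>1\<close> iff the sum of the \<open>p\<^sub>n\<close> diverges. The Stieltjes transform is the case \<open>i = 0\<close>
  with \<open>z = 1 / s\<close>.
\<close>

section \<open>Positive semidefinite matrices\<close>

lemma psdI:
  assumes "\<And>k l. cnj (X $ k $ l) = X $ l $ k"
    and "\<And>v. 0 \<le> Re (cinner v (X *v v))"
  shows "psd X"
  using assms by (simp add: psd_def adj_def vec_eq_iff)

lemma cinner_matrix_vector_expand:
  "cinner v (X *v v) = (\<Sum>i\<in>UNIV. \<Sum>j\<in>UNIV. cnj (v $ i) * X $ i $ j * v $ j)"
  by (simp add: cinner_def matrix_vector_mult_def sum_distrib_left mult.assoc)

lemma psd_hermitian: "psd X \<Longrightarrow> X $ l $ k = cnj (X $ k $ l)"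
  by (simp add: psd_def adj_def vec_eq_iff)

lemma matrix_axis_column: "X *v axis k c = (\<chi> i. X $ i $ k * c)"
  by (simp add: vec_eq_iff matrix_vector_mult_def axis_def if_distrib[where f="(*) _"] cong: if_cong)

lemma cinner_axis: "cinner (axis k c) w = cnj c * w $ k"
proof -
  have "cinner (axis k c) w = (\<Sum>i\<in>UNIV. if i = k then cnj c * w $ k else 0)"
    unfolding cinner_def by (rule sum.cong) (auto simp: axis_def)
  then show ?thesis by simp
qed

lemma cinner_add_left: "cinner (u + v) w = cinner u w + cinner v w"
  by (simp add: cinner_def sum.distrib distrib_right)

lemma cinner_two_coordinates:
  "cinner (axis k 1 + axis l c) (X *v (axis k 1 + axis l c)) =
    X $ k $ k + X $ k $ l * c + cnj c * X $ l $ k + cnj c * X $ l $ l * c"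
  by (simp add: cinner_add_left matrix_vector_right_distrib cinner_axis matrix_axis_column distrib_left
      mult.assoc)

lemma psd_diag:
  assumes "psd X"
  shows "0 \<le> Re (X $ k $ k)" "Im (X $ k $ k) = 0"
proof -
  have "cinner (axis k 1) (X *v axis k 1) = X $ k $ k"
    by (simp add: cinner_axis matrix_axis_column)
  then show "0 \<le> Re (X $ k $ k)"
    using assms unfolding psd_def by metis
  show "Im (X $ k $ k) = 0"
    using psd_hermitian[OF assms, of k k] by (simp add: complex_eq_iff)
qed

text \<open>Positivity of the form at \<open>axis k 1 + axis l c\<close> with
  \<open>c = 1, -1\<close> controls the real part of the entry, and with
  \<open>c = \<i>, -\<i>\<close> its imaginary part. The constant is crude; what matters is that a
  zero diagonal forces all entries to vanish.\<close>

lemma psd_entry_bound: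
  assumes "psd X"
  shows "norm (X $ k $ l) \<le> 2 * Re (X $ k $ k) + 2 * Re (X $ l $ l)"
proof -
  have form: "0 \<le> Re (X $ k $ k + X $ k $ l * c + cnj c * X $ l $ k + cnj c * X $ l $ l * c)" for c
    using assms unfolding psd_def cinner_two_coordinates[symmetric] by blast
  have h: "X $ l $ k = cnj (X $ k $ l)"
    by (rule psd_hermitian[OF assms])
  have "\<bar>Re (X $ k $ l)\<bar> \<le> Re (X $ k $ k) + Re (X $ l $ l)"
    "\<bar>Im (X $ k $ l)\<bar> \<le> Re (X $ k $ k) + Re (X $ l $ l)"
    using form[of 1] form[of "-1"] form[of \<i>] form[of "-\<i>"] psd_diag[OF assms, of k] psd_diag[OF assms, of l]
    by (simp_all add: h)
  then show ?thesis
    using cmod_le[of "X $ k $ l"] by linarith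
qed

lemma psd_trace:
  assumes "psd X"
  shows "0 \<le> Re (trace X)" "Im (trace X) = 0" "Re (X $ k $ k) \<le> Re (trace X)"
  using psd_diag[OF assms]
  by (auto simp: trace_def sum_nonneg intro: member_le_sum[where f="\<lambda>k. Re (X $ k $ k)"])

lemma psd_entry_le_trace:
  assumes "psd X"
  shows "norm (X $ k $ l) \<le> 4 * Re (trace X)"
  using psd_entry_bound[OF assms, of k l] psd_trace(3)[OF assms, of k] psd_trace(3)[OF assms, of l]
  by linarith

section \<open>Signed measures\<close>

text \<open>The real counterpart of \<open>complex_measure\<close>, so that real and imaginary parts
  of entries and quadratic forms of \<open>W\<close> can be treated separately.\<close>

definition signed_measure :: "(real set \<Rightarrow> real) \<Rightarrow> bool" where
  "signed_measure m \<longleftrightarrow>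
     (\<forall>E :: nat \<Rightarrow> real set. range E \<subseteq> sets borel \<longrightarrow> disjoint_family E \<longrightarrow>
        (\<lambda>i. m (E i)) sums m (\<Union>i. E i))"

lemma signed_measureD:
  fixes E :: "nat \<Rightarrow> real set"
  shows "signed_measure m \<Longrightarrow> range E \<subseteq> sets borel \<Longrightarrow> disjoint_family E \<Longrightarrow>
    (\<lambda>i. m (E i)) sums m (\<Union>i. E i)"
  by (simp add: signed_measure_def)

lemma complex_measure_Re: "complex_measure \<nu> \<Longrightarrow> signed_measure (\<lambda>E. Re (\<nu> E))"
  and complex_measure_Im: "complex_measure \<nu> \<Longrightarrow> signed_measure (\<lambda>E. Im (\<nu> E))"
  by (auto simp: complex_measure_def signed_measure_def intro: sums_Re sums_Im)

context
  fixes m :: "real set \<Rightarrow> real"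
  assumes m: "signed_measure m"
begin

lemma signed_measure_empty: "m {} = 0"
proof -
  \<comment> \<open>A constant series converges only if its terms are 0.\<close>
  have "(\<lambda>i::nat. m {}) sums m {}"
    using signed_measureD[OF m, of "\<lambda>_. {}"] by (simp add: disjoint_family_on_def)
  then show ?thesis
    by (metis sums_summable summable_const_iff)
qed

lemma signed_measure_Un:
  assumes "A \<in> sets borel" "B \<in> sets borel" "A \<inter> B = {}"
  shows "m (A \<union> B) = m A + m B"
proof -
  have "(\<lambda>i. m (binaryset A B i)) sums m (\<Union>i. binaryset A B i)"
  proof (rule signed_measureD[OF m])
    show "range (binaryset A B) \<subseteq> sets borel"
      using assms by (simp add: range_binaryset_eq)
    show "disjoint_family (binaryset A B)"
      using assms(3) by (auto simp: disjoint_family_on_def binaryset_def)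
  qed
  moreover have "(\<lambda>i. m (binaryset A B i)) sums (m A + m B)"
    by (rule binaryset_sums) (rule signed_measure_empty)
  ultimately show ?thesis
    by (simp add: UN_binaryset_eq sums_unique2)
qed

lemma signed_measure_Diff:
  assumes "A \<in> sets borel" "B \<in> sets borel" "B \<subseteq> A"
  shows "m (A - B) = m A - m B"
proof -
  have "(A - B) \<inter> B = {}" "A - B \<union> B = A"
    using assms(3) by auto
  with signed_measure_Un[of "A - B" B] assms show ?thesis
    by simp
qed

text \<open>The differences of consecutive sets are disjoint with the same union, and their values
  telescope; starting at the empty set removes the initial term.\<close>

lemma signed_measure_incseq:
  fixes A :: "nat \<Rightarrow> real set"
  assumes A: "\<And>i. A i \<in> sets borel" and inc: "incseq A" and A0: "A 0 = {}"
  shows "(\<lambda>i. m (A i)) \<longlonglongrightarrow> m (\<Union>i. A i)"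
proof -
  have step: "A i \<subseteq> A (Suc i)" for i
    using inc by (simp add: incseq_SucD)
  have "(\<lambda>i. m (A (Suc i) - A i)) sums m (\<Union>i. A (Suc i) - A i)"
    using A step by (intro signed_measureD[OF m] disjoint_family_Suc) auto
  moreover have "(\<Union>i. A (Suc i) - A i) = (\<Union>i. A i)"
  proof (intro equalityI subsetI)
    fix x assume "x \<in> (\<Union>i. A i)"
    then obtain i where "x \<in> A i" by auto
    then show "x \<in> (\<Union>i. A (Suc i) - A i)"
      by (induction i) (use A0 in auto)
  qed auto
  moreover have "(\<Sum>i<n. m (A (Suc i) - A i)) = m (A n)" for n
    using sum_lessThan_telescope[of "\<lambda>i. m (A i)" n]
    by (simp add: signed_measure_Diff[OF A A step] A0 signed_measure_empty)
  ultimately show ?thesis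
    by (simp add: sums_def)
qed

text \<open>
  The distribution function of \<open>m\<close> is nondecreasing and right continuous, and \<open>m\<close> coincides with
  the Stieltjes measure that it defines.
\<close>

lemma signed_measure_nonneg:
  assumes int: "\<And>x y. x < y \<Longrightarrow> 0 \<le> m {x<..y}" and E: "E \<in> sets borel"
  shows "0 \<le> m E"
proof -
  define F where "F x = m {..x}" for x
  have Ioc: "m {x<..y} = F y - F x" if "x \<le> y" for x y
  proof -
    have "{..y} - {..x} = {x<..y}" by auto
    then show ?thesis
      using signed_measure_Diff[of "{..y}" "{..x}"] that by (simp add: F_def)
  qed
  have mono: "F x \<le> F y" if "x \<le> y" for x y
    using int[of x y] Ioc[OF that] that by (cases "x = y") auto
  have rc: "continuous (at_right a) F" for a
  proof -
    \<comment> \<open>Right continuity becomes continuity along the increasing sets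
      \<open>{u n<..u 0}\<close>, the first of which is empty, as
      \<open>signed_measure_incseq\<close> demands.\<close>
    define u where "u n = a + 1 / real (Suc n)" for n
    have udec: "u n \<le> u k" if "k \<le> n" for k n
      using that by (simp add: u_def frac_le)
    have ulim: "u \<longlonglongrightarrow> a"
      unfolding u_def using tendsto_add[OF tendsto_const LIMSEQ_inverse_real_of_nat, of a]
      by (simp add: inverse_eq_divide)
    have "(\<lambda>n. m {u n<..u 0}) \<longlonglongrightarrow> m (\<Union>n. {u n<..u 0})"
      by (rule signed_measure_incseq) (auto simp: incseq_def dest: udec)
    also have "(\<Union>n. {u n<..u 0}) = {a<..u 0}"
    proof (intro equalityI subsetI)
      fix x assume x: "x \<in> {a<..u 0}"
      then have "eventually (\<lambda>n. u n < x) sequentially"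
        using order_tendstoD(2)[OF ulim, of x] by simp
      then show "x \<in> (\<Union>n. {u n<..u 0})"
        using x by (auto dest: eventually_happens)
    next
      fix x assume "x \<in> (\<Union>n. {u n<..u 0})"
      then obtain n where "u n < x" "x \<le> u 0" by auto
      moreover have "a < u n" by (simp add: u_def)
      ultimately show "x \<in> {a<..u 0}" by simp
    qed
    also have "m {a<..u 0} = F (u 0) - F a"
      by (rule Ioc) (simp add: u_def)
    finally have "(\<lambda>n. F (u 0) - F (u n)) \<longlonglongrightarrow> F (u 0) - F a"
      by (simp add: Ioc udec)
    then have Flim: "(\<lambda>n. F (u n)) \<longlonglongrightarrow> F a"
      using tendsto_diff[OF tendsto_const[of "F (u 0)"], of "\<lambda>n. F (u 0) - F (u n)"] by fastforce
    \<comment> \<open>Monotonicity gives the lower estimate and promotes the limit along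
      \<open>u\<close> to a full one-sided limit.\<close>
    show ?thesis
      unfolding continuous_within
    proof (rule order_tendstoI)
      fix c assume "c < F a"
      then show "\<forall>\<^sub>F x in at_right a. c < F x"
        using mono[of a] by (auto simp: eventually_at_filter intro!: always_eventually elim: less_le_trans)
    next
      fix c assume "F a < c"
      then obtain n where n: "F (u n) < c"
        using eventually_happens[OF order_tendstoD(2)[OF Flim]] by auto
      have "a < u n" by (simp add: u_def)
      then show "\<forall>\<^sub>F x in at_right a. F x < c"
        unfolding eventually_at_right_field
        using le_less_trans[OF mono n] by (intro exI[of _ "u n"]) auto
    qed
  qed
  let ?M = "interval_measure F"
  have em: "emeasure ?M {x<..y} = ennreal (m {x<..y})" if "x \<le> y" for x y
    using emeasure_interval_measure_Ioc[OF that mono rc] by (simp add: Ioc that)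
  have UN: "(\<Union>n. {- real n<..real n}) = UNIV"
  proof (intro equalityI subsetI)
    fix x :: real
    obtain n where "\<bar>x\<bar> < real n" using reals_Archimedean2 by blast
    then have "x \<in> {- real n<..real n}" by auto
    then show "x \<in> (\<Union>n. {- real n<..real n})" by blast
  qed auto
  have inc: "incseq (\<lambda>n. {- real n<..real n})"
    by (rule incseq_SucI) auto
  have "(\<lambda>n. emeasure ?M {- real n<..real n}) \<longlonglongrightarrow> emeasure ?M UNIV"
    using Lim_emeasure_incseq[of "\<lambda>n. {- real n<..real n}" ?M] inc UN
    by (simp add: image_subset_iff)
  moreover have mlim: "(\<lambda>n. m {- real n<..real n}) \<longlonglongrightarrow> m UNIV"
    using signed_measure_incseq[of "\<lambda>n. {- real n<..real n}"] inc UN by auto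
  then have "(\<lambda>n. emeasure ?M {- real n<..real n}) \<longlonglongrightarrow> ennreal (m UNIV)"
    by (simp add: em)
  \<comment> \<open>The total mass is thereby a finite number, which the complement case of the
    induction below relies on.\<close>
  ultimately have total: "emeasure ?M UNIV = ennreal (m UNIV)"
    by (rule LIMSEQ_unique)
  have mU: "0 \<le> m UNIV"
    by (rule LIMSEQ_le_const[OF mlim]) (auto simp: int intro!: exI[of _ 1])
  interpret finite_measure ?M
    by (rule finite_measureI) (simp add: total)
  \<comment> \<open>Half-open intervals form an intersection-stable generator of the Borel sets, so
    agreement spreads from them by Dynkin induction.\<close>
  have "Int_stable (range (\<lambda>(a, b). {a <.. b::real}))"
    by (auto simp: Int_stable_def)
  moreover have "range (\<lambda>(a, b). {a <.. b::real}) \<subseteq> Pow UNIV"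
    by simp
  moreover have "E \<in> sigma_sets UNIV (range (\<lambda>(a, b). {a <.. b::real}))"
    using E by (subst (asm) borel_sigma_sets_Ioc) simp
  ultimately have "measure ?M E = m E"
  proof (induction rule: sigma_sets_induct_disjoint)
    case (basic A)
    then obtain a b where A: "A = {a<..b}" by auto
    show ?case
      using em[of a b] int[of a b]
      by (cases "a < b") (simp_all add: A measure_def signed_measure_empty)
  next
    case (compl A)
    then have "A \<in> sets borel"
      by (subst borel_sigma_sets_Ioc) simp
    then show ?case
      using compl finite_measure_compl[of A] signed_measure_Diff[of UNIV A] mU
      by (simp add: total measure_def)
  next
    case (union A)
    then have *: "range A \<subseteq> sets borel"
      by (subst borel_sigma_sets_Ioc) simp
    have "(\<lambda>i. measure ?M (A i)) sums measure ?M (\<Union>i. A i)"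
      using * union by (intro finite_measure_UNION) auto
    then show ?case
      using signed_measureD[OF m *] union by (simp add: sums_unique2)
  qed (auto simp: signed_measure_empty)
  then show ?thesis
    by (metis measure_nonneg)
qed

end

section \<open>From intervals to Borel sets: positivity of matrix-valued weights\<close>

lemma signed_measure_minus: "signed_measure m \<Longrightarrow> signed_measure (\<lambda>E. - m E)"
  by (auto simp: signed_measure_def intro: sums_minus)

lemma signed_measure_eq_0:
  assumes m: "signed_measure m" and int: "\<And>x y. x < y \<Longrightarrow> m {x<..y} = 0" and E: "E \<in> sets borel"
  shows "m E = 0"
  using signed_measure_nonneg[OF m _ E] signed_measure_nonneg[OF signed_measure_minus[OF m] _ E] int
  by (simp add: order_antisym)

lemma complex_measure_cmult: "complex_measure \<nu> \<Longrightarrow> complex_measure (\<lambda>E. c * \<nu> E)"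
  and complex_measure_mult_right: "complex_measure \<nu> \<Longrightarrow> complex_measure (\<lambda>E. \<nu> E * c)"
  and complex_measure_cnj: "complex_measure \<nu> \<Longrightarrow> complex_measure (\<lambda>E. cnj (\<nu> E))"
  and complex_measure_diff:
    "complex_measure \<nu> \<Longrightarrow> complex_measure \<mu> \<Longrightarrow> complex_measure (\<lambda>E. \<nu> E - \<mu> E)"
  and complex_measure_sum:
    "(\<And>i. i \<in> I \<Longrightarrow> complex_measure (f i)) \<Longrightarrow> complex_measure (\<lambda>E. \<Sum>i\<in>I. f i E)"
  by (auto simp: complex_measure_def sums_cnj intro: sums_mult sums_mult2 sums_diff sums_sum)

text \<open>For fixed \<open>v\<close> the quadratic form of \<open>W E\<close> is a complex measure
  in \<open>E\<close> whose real part is nonnegative on half-open intervals, hence on all Borel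
  sets. Hermitian symmetry follows in the same way: its defect is a complex measure vanishing on
  these intervals.\<close>

lemma weight_matrix_psd:
  assumes W: "weight_matrix W" and E: "E \<in> sets borel"
  shows "psd (W E)"
proof -
  have cm: "complex_measure (\<lambda>E. W E $ k $ l)" for k l
    using W by (simp add: weight_matrix_def)
  have Ioc: "W {x<..y} = W {..y} - W {..x}" if "x < y" for x y
  proof -
    have "{..y} - {..x} = {x<..y}" by auto
    then have "Re (W {x<..y} $ k $ l) = Re (W {..y} $ k $ l) - Re (W {..x} $ k $ l)"
      "Im (W {x<..y} $ k $ l) = Im (W {..y} $ k $ l) - Im (W {..x} $ k $ l)" for k l
      using signed_measure_Diff[OF complex_measure_Re[OF cm[of k l]], of "{..y}" "{..x}"]
        signed_measure_Diff[OF complex_measure_Im[OF cm[of k l]], of "{..y}" "{..x}"] that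
      by auto
    then show ?thesis
      by (simp add: vec_eq_iff complex_eq_iff)
  qed
  have psd_Ioc: "psd (W {x<..y})" if "x < y" for x y
    using W that by (simp add: Ioc weight_matrix_def)
  show ?thesis
  proof (rule psdI)
    fix k l
    have cm': "complex_measure (\<lambda>E. W E $ l $ k - cnj (W E $ k $ l))"
      by (intro complex_measure_diff complex_measure_cnj cm)
    have "Re (W E $ l $ k - cnj (W E $ k $ l)) = 0" "Im (W E $ l $ k - cnj (W E $ k $ l)) = 0"
      by (rule signed_measure_eq_0[OF complex_measure_Re[OF cm'] _ E]
          signed_measure_eq_0[OF complex_measure_Im[OF cm'] _ E],
          use psd_hermitian[OF psd_Ioc, of _ _ l k] in simp)+
    then show "cnj (W E $ k $ l) = W E $ l $ k"
      by (simp add: complex_eq_iff)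
  next
    fix v
    have "complex_measure (\<lambda>E. cinner v (W E *v v))"
      unfolding cinner_matrix_vector_expand
      by (intro complex_measure_sum complex_measure_mult_right complex_measure_cmult cm)
    from signed_measure_nonneg[OF complex_measure_Re[OF this] _ E]
    show "0 \<le> Re (cinner v (W E *v v))"
      using psd_Ioc unfolding psd_def by blast
  qed
qed

section \<open>Integration against compactly supported complex measures\<close>

lemma space_jordan_pos [simp]: "space (jordan_pos m) = UNIV"
  and sets_jordan_pos [simp, measurable_cong]: "sets (jordan_pos m) = sets borel"
proof -
  show "space (jordan_pos m) = UNIV"
    by (simp add: jordan_pos_def space_measure_of_conv)
  show "sets (jordan_pos m) = sets borel"
    using sets.sigma_sets_eq[of "borel :: real measure"] by (simp add: jordan_pos_def sets_measure_of_conv)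
qed

text \<open>By monotonicity the supremum is attained at \<open>E\<close> itself, so the defining set
  function is \<open>m\<close>, hence countably additive, and \<open>measure_of\<close> keeps its
  values.\<close>

lemma emeasure_jordan_pos_nonneg:
  assumes m: "signed_measure m" and nonneg: "\<And>E. E \<in> sets borel \<Longrightarrow> 0 \<le> m E"
    and E: "E \<in> sets borel"
  shows "emeasure (jordan_pos m) E = ennreal (m E)"
proof -
  have SUP_eq: "(SUP F \<in> {F \<in> sets borel. F \<subseteq> E}. ennreal (m F)) = ennreal (m E)"
    if "E \<in> sets borel" for E
  proof (rule antisym)
    show "(SUP F \<in> {F \<in> sets borel. F \<subseteq> E}. ennreal (m F)) \<le> ennreal (m E)"
    proof (rule SUP_least)
      fix F assume "F \<in> {F \<in> sets borel. F \<subseteq> E}"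
      then have "m F \<le> m E"
        using signed_measure_Diff[OF m that, of F] nonneg[of "E - F"] that by auto
      then show "ennreal (m F) \<le> ennreal (m E)" by (rule ennreal_leI)
    qed
    show "ennreal (m E) \<le> (SUP F \<in> {F \<in> sets borel. F \<subseteq> E}. ennreal (m F))"
      using that by (intro SUP_upper) auto
  qed
  have "emeasure (jordan_pos m) E = (SUP F \<in> {F \<in> sets borel. F \<subseteq> E}. ennreal (m F))"
  proof (rule emeasure_measure_of[OF jordan_pos_def])
    show "positive (sets (jordan_pos m)) (\<lambda>E. SUP F \<in> {F \<in> sets borel. F \<subseteq> E}. ennreal (m F))"
      by (simp add: positive_def SUP_eq signed_measure_empty[OF m])
    show "countably_additive (sets (jordan_pos m)) (\<lambda>E. SUP F \<in> {F \<in> sets borel. F \<subseteq> E}. ennreal (m F))"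
    proof (rule countably_additiveI)
      fix A :: "nat \<Rightarrow> real set"
      assume A: "range A \<subseteq> sets (jordan_pos m)" and disj: "disjoint_family A"
      have 1: "(\<Union>i. A i) \<in> sets borel" "A i \<in> sets borel" for i
        using A by auto
      have "(\<Sum>i. ennreal (m (A i))) = ennreal (m (\<Union>i. A i))"
        using signed_measureD[OF m _ disj] A 1 nonneg
        by (subst suminf_ennreal_eq[where x="m (\<Union>i. A i)"]) auto
      then show "(\<Sum>i. SUP F \<in> {F \<in> sets borel. F \<subseteq> A i}. ennreal (m F)) =
          (SUP F \<in> {F \<in> sets borel. F \<subseteq> (\<Union>i. A i)}. ennreal (m F))"
        by (simp add: SUP_eq 1)
    qed
  qed (use E in auto)
  then show ?thesis
    by (simp add: SUP_eq E)
qed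

text \<open>\<open>measure_of\<close> yields either the given set function or 0, and both vanish at
  \<open>E\<close>, whether or not that function is countably additive.\<close>

lemma emeasure_jordan_pos_eq_0:
  assumes "\<And>F. F \<in> sets borel \<Longrightarrow> F \<subseteq> E \<Longrightarrow> m F \<le> 0"
  shows "emeasure (jordan_pos m) E = 0"
proof -
  have "(SUP F \<in> {F \<in> sets borel. F \<subseteq> E}. ennreal (m F)) = 0"
    using assms by (auto intro!: SUP_eqI simp: ennreal_neg)
  then show ?thesis
    by (simp add: jordan_pos_def emeasure_measure_of_conv)
qed

lemma AE_jordan_pos_in:
  assumes "S \<in> sets borel" and "\<And>F. F \<in> sets borel \<Longrightarrow> F \<inter> S = {} \<Longrightarrow> m F \<le> 0"
  shows "AE x in jordan_pos m. x \<in> S"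
proof (rule AE_I)
  show "{x \<in> space (jordan_pos m). x \<notin> S} \<subseteq> - S" by auto
  show "emeasure (jordan_pos m) (- S) = 0"
    using assms(2) by (intro emeasure_jordan_pos_eq_0) auto
  show "- S \<in> sets (jordan_pos m)"
    using assms(1) by auto
qed

lemma integral_jordan_pos_nonpos:
  fixes f :: "real \<Rightarrow> complex"
  assumes "\<And>F. F \<in> sets borel \<Longrightarrow> m F \<le> 0"
  shows "integral\<^sup>L (jordan_pos m) f = 0"
  using AE_jordan_pos_in[of "{}" m] assms by (intro integral_eq_zero_AE) auto

lemma cm_integral_nonneg_measure:
  assumes \<nu>: "complex_measure \<nu>" and nonneg: "\<And>E. E \<in> sets borel \<Longrightarrow> 0 \<le> Re (\<nu> E)"
    and real: "\<And>E. E \<in> sets borel \<Longrightarrow> Im (\<nu> E) = 0"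
  shows "cm_integral \<nu> f = integral\<^sup>L (jordan_pos (\<lambda>E. Re (\<nu> E))) f"
  using nonneg real by (simp add: cm_integral_def integral_jordan_pos_nonpos)

text \<open>Markov's inequality for \<open>x ^ (2 * n)\<close> bounds the mass of
  \<open>r \<le> \<bar>x\<bar>\<close> by \<open>C / r ^ (2 * n)\<close> for every \<open>n\<close>,
  which tends to 0 when \<open>r > 1\<close>. Even powers are nonnegative and increase with
  \<open>\<bar>x\<bar>\<close>.\<close>

lemma AE_abs_le_1_of_bounded_moments:
  fixes M :: "real measure"
  assumes sets [measurable_cong]: "sets M = sets borel"
    and int: "\<And>n. integrable M (\<lambda>x. x ^ (2 * n))"
    and bound: "\<And>n. (\<integral>x. x ^ (2 * n) \<partial>M) \<le> C"
  shows "AE x in M. \<bar>x\<bar> \<le> 1"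
proof -
  have space: "space M = UNIV"
    using sets_eq_imp_space_eq[OF sets] by simp
  have "AE x in M. \<bar>x\<bar> < r" if r: "1 < r" for r
  proof -
    have bd: "emeasure M {x. r \<le> \<bar>x\<bar>} \<le> ennreal (C * (1 / r ^ 2) ^ n)" for n
    proof -
      have "emeasure M {x \<in> space M. x ^ (2 * n) \<ge> r ^ (2 * n)} \<le>
          ennreal (1 / r ^ (2 * n) * (\<integral>x. x ^ (2 * n) \<partial>M))"
        using r by (intro integral_Markov_inequality int) (auto simp: power_mult)
      also have "\<dots> \<le> ennreal (C * (1 / r ^ 2) ^ n)"
        using r bound[of n]
        by (intro ennreal_leI) (simp add: power_mult power_divide divide_right_mono)
      finally have "emeasure M {x \<in> space M. x ^ (2 * n) \<ge> r ^ (2 * n)} \<le> \<dots>" .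
      moreover have "{x. r \<le> \<bar>x\<bar>} \<subseteq> {x \<in> space M. x ^ (2 * n) \<ge> r ^ (2 * n)}"
        using r power_mono[of r "\<bar>x\<bar>" "2 * n" for x] by (auto simp: space power_even_abs)
      then have "emeasure M {x. r \<le> \<bar>x\<bar>} \<le> emeasure M {x \<in> space M. x ^ (2 * n) \<ge> r ^ (2 * n)}"
        by (rule emeasure_mono) measurable
      ultimately show ?thesis by (rule order_trans[rotated])
    qed
    have "norm (1 / r ^ 2) < 1"
      using r one_less_power[OF r, of 2] by simp
    then have "(\<lambda>n. (1 / r ^ 2) ^ n) \<longlonglongrightarrow> 0"
      by (rule LIMSEQ_power_zero)
    then have "(\<lambda>n. ennreal (C * (1 / r ^ 2) ^ n)) \<longlonglongrightarrow> ennreal (C * 0)"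
      by (intro tendsto_ennrealI tendsto_mult_left)
    from LIMSEQ_le_const[OF this] bd have "emeasure M {x. r \<le> \<bar>x\<bar>} = 0"
      by auto
    moreover have "{x. r \<le> \<bar>x\<bar>} \<in> sets M" 
      by measurable
    ultimately show ?thesis
      by (intro AE_I[of _ _ "{x. r \<le> \<bar>x\<bar>}"]) auto
  qed
  \<comment> \<open>Countably many radii decreasing to 1 keep the exceptional set null.\<close>
  then have "AE x in M. \<forall>n. \<bar>x\<bar> < 1 + 1 / real (Suc n)"
    by (subst AE_all_countable) auto
  then show ?thesis
  proof eventually_elim
    fix x :: real assume *: "\<forall>n. \<bar>x\<bar> < 1 + 1 / real (Suc n)"
    show "\<bar>x\<bar> \<le> 1"
    proof (rule field_le_epsilon)
      fix e :: real assume "0 < e"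
      then obtain n where "1 / real (Suc n) < e"
        using nat_approx_posE by blast
      then show "\<bar>x\<bar> \<le> 1 + e" using *[rule_format, of n] by linarith
    qed
  qed
qed

text \<open>Almost everywhere the \<open>n\<close>-th term is dominated by
  \<open>\<bar>s\<bar> ^ n * norm (g x)\<close>, so series and integral may be exchanged; the inner
  series is geometric with ratio \<open>s * x\<close>.\<close>

lemma integral_geometric_sums:
  fixes g :: "real \<Rightarrow> complex"
  assumes int: "integrable M g" and AE: "AE x in M. \<bar>x\<bar> \<le> 1"
    and sets [measurable_cong]: "sets M = sets borel" and s: "\<bar>s\<bar> < 1"
  shows "(\<lambda>n. complex_of_real (s ^ n) * (\<integral>x. x ^ n *\<^sub>R g x \<partial>M)) sums
    (\<integral>x. (1 / (1 - s * x)) *\<^sub>R g x \<partial>M)"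
proof -
  note [measurable] = borel_measurable_integrable[OF int]
  have int_pow: "integrable M (\<lambda>x. x ^ n *\<^sub>R g x)" for n
  proof (rule Bochner_Integration.integrable_bound[OF int])
    show "AE x in M. norm (x ^ n *\<^sub>R g x) \<le> norm (g x)"
      using AE by eventually_elim (auto simp: power_abs intro!: mult_left_le_one_le power_le_one)
  qed measurable
  have "(\<lambda>n. \<integral>x. s ^ n *\<^sub>R x ^ n *\<^sub>R g x \<partial>M) sums (\<integral>x. (\<Sum>n. s ^ n *\<^sub>R x ^ n *\<^sub>R g x) \<partial>M)"
  proof (rule sums_integral)
    show "integrable M (\<lambda>x. s ^ n *\<^sub>R x ^ n *\<^sub>R g x)" for n
      by (intro integrable_scaleR_right int_pow)
    show "AE x in M. summable (\<lambda>n. norm (s ^ n *\<^sub>R x ^ n *\<^sub>R g x))"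
      using AE
    proof eventually_elim
      fix x :: real assume "\<bar>x\<bar> \<le> 1"
      then have "\<bar>s * x\<bar> < 1"
        using s by (simp add: abs_mult) (metis abs_ge_zero le_less_trans mult.right_neutral mult_left_mono)
      then have "summable (\<lambda>n. \<bar>s * x\<bar> ^ n * norm (g x))"
        by (intro summable_mult2 summable_geometric) simp
      then show "summable (\<lambda>n. norm (s ^ n *\<^sub>R x ^ n *\<^sub>R g x))"
        by (simp add: power_abs abs_mult power_mult_distrib mult.assoc)
    qed
    show "summable (\<lambda>n. \<integral>x. norm (s ^ n *\<^sub>R x ^ n *\<^sub>R g x) \<partial>M)"
    proof (rule summable_comparison_test)
      show "summable (\<lambda>n. \<bar>s\<bar> ^ n * (\<integral>x. norm (g x) \<partial>M))"
        using s by (intro summable_mult2 summable_geometric) simp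
      have "(\<integral>x. norm (s ^ n *\<^sub>R x ^ n *\<^sub>R g x) \<partial>M) \<le> (\<integral>x. \<bar>s\<bar> ^ n * norm (g x) \<partial>M)" for n
      proof (rule integral_mono_AE)
        show "AE x in M. norm (s ^ n *\<^sub>R x ^ n *\<^sub>R g x) \<le> \<bar>s\<bar> ^ n * norm (g x)"
          using AE by eventually_elim
            (auto simp: power_abs abs_mult mult.assoc intro!: mult_left_mono mult_left_le_one_le power_le_one)
      qed (intro integrable_norm integrable_scaleR_right integrable_mult_right int_pow int)+
      then show "\<exists>N. \<forall>n\<ge>N. norm (\<integral>x. norm (s ^ n *\<^sub>R x ^ n *\<^sub>R g x) \<partial>M) \<le> \<bar>s\<bar> ^ n * (\<integral>x. norm (g x) \<partial>M)"
        by (simp add: integral_nonneg_AE)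
    qed
  qed
  also have "(\<integral>x. (\<Sum>n. s ^ n *\<^sub>R x ^ n *\<^sub>R g x) \<partial>M) = (\<integral>x. (1 / (1 - s * x)) *\<^sub>R g x \<partial>M)"
  proof (rule integral_cong_AE)
    show "AE x in M. (\<Sum>n. s ^ n *\<^sub>R x ^ n *\<^sub>R g x) = (1 / (1 - s * x)) *\<^sub>R g x"
      using AE
    proof eventually_elim
      fix x :: real assume "\<bar>x\<bar> \<le> 1"
      then have "\<bar>s * x\<bar> < 1"
        using s by (simp add: abs_mult) (metis abs_ge_zero le_less_trans mult.right_neutral mult_left_mono)
      then have "(\<lambda>n. (s * x) ^ n *\<^sub>R g x) sums ((1 / (1 - s * x)) *\<^sub>R g x)"
        by (intro sums_scaleR_left geometric_sums) simp
      then show "(\<Sum>n. s ^ n *\<^sub>R x ^ n *\<^sub>R g x) = (1 / (1 - s * x)) *\<^sub>R g x"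
        by (simp add: power_mult_distrib sums_iff)
    qed
  qed measurable
  finally show ?thesis
    by (simp add: scaleR_conv_of_real)
qed

text \<open>
  No Jordan decomposition theorem is needed: \<open>jordan_pos\<close> gives mass \<open>0\<close> to the complement of
  \<open>[-1, 1]\<close> even in the degenerate case where its defining set function is not a measure.
\<close>

lemma cm_integral_geometric_sums:
  assumes int: "cm_integrable \<nu> g"
    and supp: "\<And>E. E \<in> sets borel \<Longrightarrow> E \<inter> {-1..1} = {} \<Longrightarrow> \<nu> E = 0" and s: "\<bar>s\<bar> < 1"
  shows "(\<lambda>n. complex_of_real (s ^ n) * cm_integral \<nu> (\<lambda>x. x ^ n *\<^sub>R g x)) sums
    cm_integral \<nu> (\<lambda>x. (1 / (1 - s * x)) *\<^sub>R g x)"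
proof -
  have AE: "AE x in jordan_pos m. \<bar>x\<bar> \<le> 1"
    if "\<And>E. E \<in> sets borel \<Longrightarrow> E \<inter> {-1..1} = {} \<Longrightarrow> m E \<le> 0" for m
    using AE_jordan_pos_in[OF _ that, of "{-1..1}"] by (auto simp: abs_le_iff elim!: eventually_mono)
  \<comment> \<open>The scalar is distributed over the four Jordan parts so that the series can be
    summed in each part separately.\<close>
  have *: "complex_of_real (s ^ n) * cm_integral \<nu> (\<lambda>x. x ^ n *\<^sub>R g x) =
      (complex_of_real (s ^ n) * (\<integral>x. x ^ n *\<^sub>R g x \<partial>jordan_pos (\<lambda>E. Re (\<nu> E))) -
       complex_of_real (s ^ n) * (\<integral>x. x ^ n *\<^sub>R g x \<partial>jordan_pos (\<lambda>E. - Re (\<nu> E)))) +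
      \<i> * (complex_of_real (s ^ n) * (\<integral>x. x ^ n *\<^sub>R g x \<partial>jordan_pos (\<lambda>E. Im (\<nu> E))) -
       complex_of_real (s ^ n) * (\<integral>x. x ^ n *\<^sub>R g x \<partial>jordan_pos (\<lambda>E. - Im (\<nu> E))))" for n
    by (simp add: cm_integral_def algebra_simps)
  show ?thesis
    unfolding * unfolding cm_integral_def
    using int unfolding cm_integrable_def
    by (intro sums_add sums_diff sums_mult integral_geometric_sums AE s) (auto simp: supp)
qed

section \<open>Support of a weight with bounded moments\<close>

lemma cm_integral_zero [simp]: "cm_integral \<nu> (\<lambda>x. 0) = 0"
  by (simp add: cm_integral_def)

lemma cm_integral_scaleR: "cm_integral \<nu> (\<lambda>x. c *\<^sub>R f x) = c *\<^sub>R cm_integral \<nu> f"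
  by (simp add: cm_integral_def algebra_simps)

text \<open>Diagonal entries are positive measures, so bounded moments confine them to
  \<open>[-1, 1]\<close>. For \<open>E\<close> outside this interval the positive semidefinite
  matrix \<open>W E\<close> has zero diagonal, hence is zero.\<close>

lemma weight_matrix_support:
  assumes W: "weight_matrix W"
    and int: "\<And>k n. cm_integrable (\<lambda>E. W E $ k $ k) (\<lambda>x. complex_of_real (x ^ n))"
    and bound: "\<And>k n. norm (cm_integral (\<lambda>E. W E $ k $ k) (\<lambda>x. complex_of_real (x ^ n))) \<le> C"
    and E: "E \<in> sets borel" "E \<inter> {-1..1} = {}"
  shows "W E $ k $ l = 0"
proof -
  have diag: "Re (W E $ k $ k) = 0" for k
  proof -
    have cm: "complex_measure (\<lambda>E. W E $ k $ k)"
      using W by (simp add: weight_matrix_def)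
    let ?M = "jordan_pos (\<lambda>E. Re (W E $ k $ k))"
    note psd = psd_diag[OF weight_matrix_psd[OF W], of _ k]
    have "integrable ?M (\<lambda>x. complex_of_real (x ^ n))" for n
      using int unfolding cm_integrable_def by blast
    then have i: "integrable ?M (\<lambda>x. x ^ n)" for n
      unfolding complex_of_real_integrable_eq .
    have "(\<integral>x. x ^ n \<partial>?M) \<le> C" for n
    proof -
      have "cm_integral (\<lambda>E. W E $ k $ k) (\<lambda>x. complex_of_real (x ^ n)) =
          complex_of_real (\<integral>x. x ^ n \<partial>?M)"
        by (rule trans[OF cm_integral_nonneg_measure[OF cm psd] integral_complex_of_real])
      then show ?thesis
        using bound[of k n] by simp
    qed
    then have "AE x in ?M. \<bar>x\<bar> \<le> 1"
      by (intro AE_abs_le_1_of_bounded_moments[where C=C] i) simp_all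
    then have "AE x in ?M. x \<notin> E"
      by eventually_elim (use E(2) in \<open>auto simp: disjoint_iff abs_le_iff\<close>)
    then have "emeasure ?M E = 0"
      using E(1) by (subst (asm) AE_iff_measurable[of E]) auto
    then show ?thesis
      using emeasure_jordan_pos_nonneg[OF complex_measure_Re[OF cm] psd(1) E(1)] psd(1)[OF E(1)]
      by simp
  qed
  then show ?thesis
    using psd_entry_bound[OF weight_matrix_psd[OF W E(1)], of k l] by simp
qed

section \<open>Boundedness of the powers of a quantum Markov chain\<close>

lemma completely_positive_psd:
  assumes "completely_positive F" "psd X"
  shows "psd (F X)"
proof -
  \<comment> \<open>Positivity is complete positivity for a single block.\<close>
  have "block_psd 1 (\<lambda>_ _. X)"
    using assms(2) by (simp add: block_psd_def psd_def)
  with assms(1) have bp: "block_psd 1 (\<lambda>_ _. F X)"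
    unfolding completely_positive_def by blast
  then have "\<forall>v. 0 \<le> Re (cinner (v 0) (F X *v v (0::nat)))"
    by (simp add: block_psd_def)
  from this[THEN spec, of "\<lambda>_. v" for v] have "0 \<le> Re (cinner v (F X *v v))" for v .
  then show ?thesis
    using bp by (simp add: block_psd_def psd_def)
qed

lemma quantum_markov_chain_psd: "quantum_markov_chain \<Phi> \<Longrightarrow> psd X \<Longrightarrow> psd (\<Phi> i j X)"
  by (simp add: quantum_markov_chain_def completely_positive_psd[of "\<Phi> i j"])

lemma psd_0: "psd 0"
  by (simp add: psd_def adj_def cinner_def vec_eq_iff)

lemma psd_add:
  assumes "psd X" "psd Y"
  shows "psd (X + Y)"
proof (rule psdI)
  show "cnj ((X + Y) $ k $ l) = (X + Y) $ l $ k" for k l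
    using psd_hermitian[OF assms(1), of k l] psd_hermitian[OF assms(2), of k l] by simp
  have "cinner v ((X + Y) *v v) = cinner v (X *v v) + cinner v (Y *v v)" for v
    by (simp add: cinner_def matrix_vector_mult_add_rdistrib distrib_left sum.distrib)
  then show "0 \<le> Re (cinner v ((X + Y) *v v))" for v
    using assms by (simp add: psd_def)
qed

lemma psd_sum: "(\<And>i. i \<in> I \<Longrightarrow> psd (f i)) \<Longrightarrow> psd (sum f I)"
  by (induction I rule: infinite_finite_induct) (auto intro: psd_0 psd_add)

lemma matrix_rep_mult_mvec:
  assumes "clinear_map F"
  shows "unvec (matrix_rep F *v v) = F (unvec v)"
  using matrix_rep_works[OF assms, of "unvec v"] by (metis mvec_unvec unvec_mvec)

lemma unvec_sum: "unvec (sum f I) = (\<Sum>i\<in>I. unvec (f i))"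
  by (induction I rule: infinite_finite_induct) (auto simp: unvec_def vec_eq_iff)

lemma matrix_vector_mult_sum_left:
  fixes f :: "'i \<Rightarrow> 'm::finite cmat"
  shows "(\<Sum>i\<in>I. f i) *v v = (\<Sum>i\<in>I. f i *v v)"
  by (induction I rule: infinite_finite_induct) (auto simp: matrix_vector_mult_add_rdistrib)

lemma matrix_vector_mult_sum_right:
  fixes M :: "'m::finite cmat"
  shows "M *v (\<Sum>i\<in>I. f i) = (\<Sum>i\<in>I. M *v f i)"
  by (induction I rule: infinite_finite_induct) (auto simp: matrix_vector_right_distrib)

lemma bounded_linear_Re_trace: "bounded_linear (\<lambda>X :: 'n::finite cmat. Re (trace X))"
  unfolding trace_def
  by (intro bounded_linear_compose[OF bounded_linear_Re] bounded_linear_sum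
      bounded_linear_compose[OF bounded_linear_vec_nth] bounded_linear_vec_nth)

text \<open>The trace is continuous and linear, so it passes through the infinite column sum; a
  finite part of a sum of nonnegative terms cannot exceed the preserved total.\<close>

lemma quantum_markov_chain_column_trace:
  assumes \<Phi>: "quantum_markov_chain \<Phi>" and X: "psd X" and K: "finite K"
  shows "(\<Sum>i\<in>K. Re (trace (\<Phi> i j X))) \<le> Re (trace X)"
proof -
  have "((\<lambda>i. \<Phi> i j X) has_sum (\<Sum>\<^sub>\<infinity>i. \<Phi> i j X)) UNIV"
    using \<Phi> by (simp add: quantum_markov_chain_def)
  from has_sum_bounded_linear[OF bounded_linear_Re_trace this]
  have "((\<lambda>i. Re (trace (\<Phi> i j X))) has_sum Re (trace X)) UNIV"
    using \<Phi> by (simp add: quantum_markov_chain_def)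
  then have "(\<lambda>i. Re (trace (\<Phi> i j X))) summable_on UNIV"
    "(\<Sum>\<^sub>\<infinity>i. Re (trace (\<Phi> i j X))) = Re (trace X)"
    by (rule has_sum_imp_summable, rule infsumI)
  moreover have "0 \<le> Re (trace (\<Phi> i j X))" for i
    by (intro psd_trace quantum_markov_chain_psd[OF \<Phi> X])
  ultimately show ?thesis
    using finite_sum_le_infsum[of "\<lambda>i. Re (trace (\<Phi> i j X))" UNIV K] K by simp
qed

section \<open>Matrix units from rank-one positive matrices\<close>

definition rank_one :: "complex ^ 'n::finite \<Rightarrow> 'n cmat" where
  "rank_one u = (\<chi> i j. u $ i * cnj (u $ j))"

lemma psd_rank_one: "psd (rank_one u)"
proof (rule psdI)
  show "cnj (rank_one u $ k $ l) = rank_one u $ l $ k" for k l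
    by (simp add: rank_one_def)
  fix v
  have "cinner v (rank_one u *v v) = cinner v u * cnj (cinner v u)"
    by (simp add: cinner_def rank_one_def matrix_vector_mult_def sum_product sum_distrib_left
        mult_ac) (rule sum.swap)
  then show "0 \<le> Re (cinner v (rank_one u *v v))"
    by (simp add: complex_mult_cnj)
qed

text \<open>Over the fourth roots of unity both \<open>c\<close> and \<open>c ^ 2\<close> sum to 0
  while \<open>c * cnj c = 1\<close>, so only one mixed term survives, four times. Matrix units are
  thus expressed by positive matrices, to which trace bounds apply.\<close>

lemma polarization_axis:
  "axis (a :: 'n::finite, b) 1 = (1/4) *s (\<Sum>c\<in>{1, -1, \<i>, -\<i>}. c *s mvec (rank_one (axis a 1 + axis b c)))"
proof -
  have "(\<Sum>c\<in>{1, -1, \<i>, -\<i>}. c * ((x + c * y) * (x' + cnj c * y'))) = 4 * (x * y')"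
    for x y x' y' :: complex
    by (simp add: complex_eq_iff) (simp add: algebra_simps)
  note * = this[of "axis a 1 $ k" "axis b 1 $ k" "axis a 1 $ l" "axis b 1 $ l" for k l]
  have "(axis b c :: complex ^ 'n) $ k = c * axis b 1 $ k" "cnj ((axis a 1 :: complex ^ 'n) $ k) = axis a 1 $ k" for a b c k
    by (simp_all add: axis_def)
  then have "(\<Sum>c\<in>{1, -1, \<i>, -\<i>}. c *s mvec (rank_one (axis a 1 + axis b c))) $ (k, l) =
      4 * (axis a 1 $ k * axis b 1 $ l)" for k l
    unfolding *[symmetric] sum_component vector_smult_component mvec_def rank_one_def
    by (intro sum.cong refl) (metis (no_types, lifting) complex_cnj_add complex_cnj_mult fst_conv snd_conv
        vec_lambda_beta vector_add_component)
  then show ?thesis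
    by (auto simp: vec_eq_iff axis_def)
qed

section \<open>Positivity and trace bounds for powers of a tridiagonal chain\<close>

context
  fixes \<Phi> :: "nat \<Rightarrow> nat \<Rightarrow> 'n::finite cmat \<Rightarrow> 'n cmat"
  assumes \<Phi>: "quantum_markov_chain \<Phi>"
    and tridiagonal: "\<And>i j. Suc j < i \<or> Suc i < j \<Longrightarrow> matrix_rep (\<Phi> i j) = 0"
begin

lemma qmc_power_Suc:
  "qmc_power \<Phi> (Suc n) i j = (\<Sum>k\<le>Suc i. matrix_rep (\<Phi> i k) ** qmc_power \<Phi> n k j)"
proof -
  have "qmc_power \<Phi> (Suc n) i j = (\<Sum>\<^sub>\<infinity>k. matrix_rep (\<Phi> i k) ** qmc_power \<Phi> n k j)"
    by (simp add: qmc_power_def)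
  \<comment> \<open>Row \<open>i\<close> meets no column beyond \<open>Suc i\<close>; the blocks
    with \<open>Suc k < i\<close> are zero too but may stay in the sum.\<close>
  also have "\<dots> = (\<Sum>\<^sub>\<infinity>k\<in>{..Suc i}. matrix_rep (\<Phi> i k) ** qmc_power \<Phi> n k j)"
    by (rule infsum_cong_neutral) (auto simp: tridiagonal)
  finally show ?thesis by simp
qed

lemma unvec_qmc_power_Suc:
  "unvec (qmc_power \<Phi> (Suc n) i j *v v) = (\<Sum>k\<le>Suc i. \<Phi> i k (unvec (qmc_power \<Phi> n k j *v v)))"
proof -
  have "clinear_map (\<Phi> i k)" for i k
    using \<Phi> by (simp add: quantum_markov_chain_def completely_positive_def)
  then show ?thesis
    by (simp only: qmc_power_Suc matrix_vector_mult_sum_left unvec_sum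
        matrix_vector_mul_assoc[symmetric] matrix_rep_mult_mvec)
qed

lemma qmc_power_psd:
  assumes X: "psd X"
  shows "psd (unvec (qmc_power \<Phi> n i j *v mvec X))"
proof (induction n arbitrary: i)
  case 0
  then show ?case
    using X by (simp add: qmc_power_def) (simp add: unvec_def zero_vec_def[symmetric] psd_0)
next
  case (Suc n)
  then show ?case
    unfolding unvec_qmc_power_Suc by (intro psd_sum quantum_markov_chain_psd[OF \<Phi>])
qed

text \<open>Trace is preserved only by whole columns, so the induction sums over vertices. Rows up
  to \<open>K\<close> draw on columns up to \<open>Suc K\<close>, hence the induction hypothesis for
  all \<open>K\<close>.\<close>

lemma qmc_power_sum_trace_le:
  assumes X: "psd X"
  shows "(\<Sum>i\<le>K. Re (trace (unvec (qmc_power \<Phi> n i j *v mvec X)))) \<le> Re (trace X)"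
proof (induction n arbitrary: K)
  case 0
  have "Re (trace (unvec (qmc_power \<Phi> 0 i j *v mvec X))) = (if i = j then Re (trace X) else 0)" for i
    by (simp add: qmc_power_def) (simp add: unvec_def trace_def)
  then show ?case
    using psd_trace(1)[OF X] by simp
next
  case (Suc n)
  define Y where "Y k = unvec (qmc_power \<Phi> n k j *v mvec X)" for k
  have Y: "psd (Y k)" for k
    unfolding Y_def by (rule qmc_power_psd[OF X])
  have pos: "0 \<le> Re (trace (\<Phi> i k (Y k)))" for i k
    by (intro psd_trace quantum_markov_chain_psd[OF \<Phi> Y])
  have lin: "Re (trace (sum f I)) = (\<Sum>i\<in>I. Re (trace (f i)))" for f :: "nat \<Rightarrow> 'n cmat" and I
    using linear_sum[OF bounded_linear.linear[OF bounded_linear_Re_trace]] .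
  have "(\<Sum>i\<le>K. Re (trace (unvec (qmc_power \<Phi> (Suc n) i j *v mvec X)))) =
      (\<Sum>i\<le>K. \<Sum>k\<le>Suc i. Re (trace (\<Phi> i k (Y k))))"
    by (simp only: unvec_qmc_power_Suc lin Y_def)
  also have "\<dots> \<le> (\<Sum>i\<le>K. \<Sum>k\<le>Suc K. Re (trace (\<Phi> i k (Y k))))"
    by (intro sum_mono sum_mono2) (auto simp: pos)
  also have "\<dots> = (\<Sum>k\<le>Suc K. \<Sum>i\<le>K. Re (trace (\<Phi> i k (Y k))))"
    by (rule sum.swap)
  also have "\<dots> \<le> (\<Sum>k\<le>Suc K. Re (trace (Y k)))"
    by (intro sum_mono quantum_markov_chain_column_trace[OF \<Phi> Y]) simp
  also have "\<dots> \<le> Re (trace X)"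
    unfolding Y_def by (rule Suc.IH)
  finally show ?case .
qed

lemma qmc_power_trace_le:
  assumes X: "psd X"
  shows "Re (trace (unvec (qmc_power \<Phi> n i j *v mvec X))) \<le> Re (trace X)"
proof -
  \<comment> \<open>In the sum on the right, the upper limit is the fixed vertex \<open>i\<close>,
    which the summation variable then shadows.\<close>
  have "Re (trace (unvec (qmc_power \<Phi> n i j *v mvec X))) \<le>
      (\<Sum>i\<le>i. Re (trace (unvec (qmc_power \<Phi> n i j *v mvec X))))"
    by (rule member_le_sum) (auto intro: psd_trace qmc_power_psd[OF X])
  also have "\<dots> \<le> Re (trace X)"
    by (rule qmc_power_sum_trace_le[OF X])
  finally show ?thesis .
qed

text \<open>Column \<open>q\<close> is the image of a matrix unit, which polarization combines from
  four rank-one matrices of trace at most 4. Entries of a positive matrix are at most 4 times its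
  trace, whence 16. Uniformity in \<open>n\<close> is what the moment argument uses.\<close>

lemma qmc_power_entry_bound: "norm (qmc_power \<Phi> n i j $ p $ q) \<le> 16"
proof -
  let ?P = "qmc_power \<Phi> n i j"
  obtain a b where q: "q = (a, b)" by fastforce
  have entry: "norm ((?P *v mvec (rank_one (axis a 1 + axis b c))) $ p) \<le> 16"
    if c: "norm c = 1" for c
  proof -
    let ?X = "rank_one (axis a 1 + axis b c)"
    have "norm (unvec (?P *v mvec ?X) $ fst p $ snd p) \<le> 4 * Re (trace (unvec (?P *v mvec ?X)))"
      by (intro psd_entry_le_trace qmc_power_psd psd_rank_one)
    also have "\<dots> \<le> 4 * Re (trace ?X)"
      using qmc_power_trace_le[OF psd_rank_one, of n i j "axis a 1 + axis b c"] by simp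
    also have "Re (trace ?X) = (\<Sum>k\<in>UNIV. (norm ((axis a 1 + axis b c) $ k))\<^sup>2)"
      by (simp only: trace_def rank_one_def vec_lambda_beta complex_norm_square[symmetric] Re_sum Re_complex_of_real)
    \<comment> \<open>For \<open>a = b\<close> the only nonzero coordinate can be
      \<open>1 + c\<close>, of squared modulus at most \<open>4 = 2 + 2\<close>; otherwise there are
      two coordinates of modulus 1.\<close>
    also have "\<dots> \<le> (\<Sum>k\<in>UNIV. (if k = a then 2 else 0) + (if k = b then 2 else 0))"
    proof (rule sum_mono)
      fix k
      have "norm (1 + c) \<le> 2"
        using norm_triangle_ineq[of 1 c] c by simp
      then have "(norm (1 + c))\<^sup>2 \<le> 4"
        using power_mono[of "norm (1 + c)" 2 2] by simp
      then show "(norm ((axis a 1 + axis b c) $ k))\<^sup>2 \<le> (if k = a then 2 else 0) + (if k = b then 2 else 0)"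
        using c by (auto simp: axis_def)
    qed
    also have "\<dots> = 4"
      by (simp add: sum.distrib)
    finally show ?thesis
      by (simp add: unvec_def)
  qed
  have "?P $ p $ q = (?P *v axis q 1) $ p"
    by (simp add: matrix_axis_column)
  also have "\<dots> = 1/4 * (\<Sum>c\<in>{1, -1, \<i>, -\<i>}. c * (?P *v mvec (rank_one (axis a 1 + axis b c))) $ p)"
    unfolding q polarization_axis
    by (simp only: vector_scalar_commute matrix_vector_mult_sum_right vector_smult_component sum_component)
  finally have "norm (?P $ p $ q) \<le>
      1/4 * (\<Sum>c\<in>{1, -1, \<i>, -\<i>}. norm (c * (?P *v mvec (rank_one (axis a 1 + axis b c))) $ p))"
    using norm_sum[of "\<lambda>c. c * (?P *v mvec (rank_one (axis a 1 + axis b c))) $ p" "{1, -1, \<i>, -\<i>}"]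
    by (simp only: norm_mult) simp
  also have "\<dots> \<le> 1/4 * (\<Sum>c\<in>{1, -1, \<i>, -\<i>}. 16)"
  proof (intro mult_left_mono sum_mono)
    fix c assume "c \<in> {1, -1, \<i>, -\<i>}"
    then have "norm c = 1" by auto
    then show "norm (c * (?P *v mvec (rank_one (axis a 1 + axis b c))) $ p) \<le> 16"
      using entry[of c] by (simp add: norm_mult)
  qed simp
  also have "\<dots> \<le> 16"
    by (simp add: card_insert_if)
  finally show ?thesis .
qed

end

section \<open>Abelian limits\<close>

text \<open>A truncated power series is at most the partial sum of \<open>p\<close> and at most
  \<open>F s\<close>. The first bound carries large values of \<open>F\<close> over to partial sums;
  the second, with continuity of the truncation at 1, gives the converse.\<close>

lemma Abel_at_top_iff:
  fixes p :: "nat \<Rightarrow> real"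
  assumes nonneg: "\<And>n. 0 \<le> p n"
    and F: "\<And>s. 0 < s \<Longrightarrow> s < 1 \<Longrightarrow> (\<lambda>n. p n * s ^ n) sums F s"
  shows "filterlim F at_top (at_left 1) \<longleftrightarrow> filterlim (\<lambda>m. \<Sum>n<m. p n) at_top sequentially"
proof
  assume lim: "filterlim F at_top (at_left 1)"
  show "filterlim (\<lambda>m. \<Sum>n<m. p n) at_top sequentially"
    unfolding filterlim_at_top
  proof
    fix Z
    have "eventually (\<lambda>s. Z + 1 \<le> F s \<and> 0 < s \<and> s < 1) (at_left 1)"
      using lim eventually_at_left_real[of 0 1] by (auto simp: filterlim_at_top eventually_conj_iff elim: eventually_mono)
    then obtain s where s: "Z + 1 \<le> F s" "0 < s" "s < 1"
      using eventually_happens by fastforce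
    have "eventually (\<lambda>m. Z < (\<Sum>n<m. p n * s ^ n)) sequentially"
      using F[OF s(2,3)] s(1) unfolding sums_def by (intro order_tendstoD(1)) auto
    then show "eventually (\<lambda>m. Z \<le> (\<Sum>n<m. p n)) sequentially"
    proof eventually_elim
      fix m assume "Z < (\<Sum>n<m. p n * s ^ n)"
      also have "\<dots> \<le> (\<Sum>n<m. p n)"
        using s by (intro sum_mono mult_left_le nonneg power_le_one) auto
      finally show "Z \<le> (\<Sum>n<m. p n)" by simp
    qed
  qed
next
  assume lim: "filterlim (\<lambda>m. \<Sum>n<m. p n) at_top sequentially"
  show "filterlim F at_top (at_left 1)"
    unfolding filterlim_at_top
  proof
    fix Z
    obtain m where m: "Z + 1 \<le> (\<Sum>n<m. p n)"
      using lim eventually_happens[of _ sequentially] by (fastforce simp: filterlim_at_top)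
    have "((\<lambda>s. \<Sum>n<m. p n * s ^ n) \<longlongrightarrow> (\<Sum>n<m. p n * 1 ^ n)) (at_left 1)"
      by (intro tendsto_intros)
    then have "eventually (\<lambda>s. Z < (\<Sum>n<m. p n * s ^ n)) (at_left 1)"
      using m by (intro order_tendstoD(1)) auto
    moreover have "eventually (\<lambda>s. 0 < s \<and> s < 1) (at_left (1::real))"
      using eventually_at_left_real[of 0 1] by simp
    ultimately show "eventually (\<lambda>s. Z \<le> F s) (at_left 1)"
    proof eventually_elim
      fix s :: real assume "Z < (\<Sum>n<m. p n * s ^ n)" "0 < s \<and> s < 1"
      moreover have "(\<Sum>n<m. p n * s ^ n) \<le> F s"
        using F[of s] \<open>0 < s \<and> s < 1\<close> sum_le_suminf[of "\<lambda>n. p n * s ^ n" "{..<m}"]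
        by (simp add: sums_iff nonneg)
      ultimately show "Z \<le> F s" by simp
    qed
  qed
qed

section \<open>The substitution \<open>z = 1 / s\<close>\<close>

lemma filterlim_inverse_at_left_1: "filterlim (\<lambda>z::real. 1 / z) (at_left 1) (at_right 1)"
proof (rule filterlim_at_withinI)
  show "((\<lambda>z::real. 1 / z) \<longlongrightarrow> 1) (at_right 1)"
    by (auto intro!: tendsto_eq_intros)
  show "\<forall>\<^sub>F z in at_right (1::real). 1 / z \<in> {..<1} - {1}"
    by (auto simp: eventually_at_filter)
qed

lemma filterlim_inverse_at_right_1: "filterlim (\<lambda>s::real. 1 / s) (at_right 1) (at_left 1)"
proof (rule filterlim_at_withinI)
  show "((\<lambda>z::real. 1 / z) \<longlongrightarrow> 1) (at_left 1)"
    by (auto intro!: tendsto_eq_intros)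
  show "\<forall>\<^sub>F s in at_left (1::real). 1 / s \<in> {1<..} - {1}"
    using eventually_at_left_real[of 0 1] by (auto elim!: eventually_mono)
qed

text \<open>At \<open>z = 1 / s\<close> the quotient is \<open>s * F s\<close>, at most
  \<open>F s\<close>; conversely the factor \<open>1 / z\<close> tends to 1 and does not affect
  divergence.\<close>

lemma filterlim_at_top_inverse_argument_iff:
  fixes F :: "real \<Rightarrow> real"
  assumes nonneg: "\<And>s. 0 < s \<Longrightarrow> s < 1 \<Longrightarrow> 0 \<le> F s"
  shows "filterlim (\<lambda>z. F (1 / z) / z) at_top (at_right 1) \<longleftrightarrow> filterlim F at_top (at_left 1)"
proof
  assume *: "filterlim (\<lambda>z. F (1 / z) / z) at_top (at_right 1)"
  have "filterlim (\<lambda>s. F (1 / (1 / s)) / (1 / s)) at_top (at_left 1)"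
    by (rule filterlim_compose[OF * filterlim_inverse_at_right_1])
  moreover have "\<forall>\<^sub>F s in at_left 1. F (1 / (1 / s)) / (1 / s) \<le> F s"
    using eventually_at_left_real[of 0 1] nonneg
    by (auto elim!: eventually_mono intro!: mult_left_le)
  ultimately show "filterlim F at_top (at_left 1)"
    by (rule filterlim_at_top_mono)
next
  assume *: "filterlim F at_top (at_left 1)"
  have "filterlim (\<lambda>z. 1 / z * F (1 / z)) at_top (at_right 1)"
    by (rule filterlim_tendsto_pos_mult_at_top[of _ 1])
      (auto intro!: tendsto_eq_intros filterlim_compose[OF * filterlim_inverse_at_left_1])
  then show "filterlim (\<lambda>z. F (1 / z) / z) at_top (at_right 1)"
    by simp
qed

section \<open>Generating functions as weight integrals\<close>

text \<open>Identity factors leave only the summand \<open>k = a\<close>, \<open>l = b\<close>. The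
  scalar \<open>r\<close> will be a power of \<open>x\<close> or the geometric kernel.\<close>

lemma weight_integral_Q_0:
  assumes "\<And>x. Q x = mat 1"
  shows "weight_integral (\<lambda>x. r x *\<^sub>R adj (Q x)) W Q $ a $ b =
    cm_integral (\<lambda>E. W E $ a $ b) (\<lambda>x. complex_of_real (r x))"
proof -
  have "weight_integral (\<lambda>x. r x *\<^sub>R adj (Q x)) W Q $ a $ b =
     (\<Sum>k\<in>UNIV. \<Sum>l\<in>UNIV. if k = a \<and> l = b
        then cm_integral (\<lambda>E. W E $ a $ b) (\<lambda>x. complex_of_real (r x)) else 0)"
    unfolding weight_integral_def vec_lambda_beta
    by (intro sum.cong refl) (auto simp: assms adj_def mat_def of_real_def)
  also have "\<dots> = (\<Sum>k\<in>UNIV. if k = a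
        then cm_integral (\<lambda>E. W E $ a $ b) (\<lambda>x. complex_of_real (r x)) else 0)"
    by (intro sum.cong refl) auto
  finally show ?thesis by simp
qed

lemma weight_integral_geometric_sums:
  assumes int: "weight_integrable F W G"
    and supp: "\<And>E k l. E \<in> sets borel \<Longrightarrow> E \<inter> {-1..1} = {} \<Longrightarrow> W E $ k $ l = 0"
    and s: "\<bar>s\<bar> < 1"
  shows "(\<lambda>n. complex_of_real (s ^ n) * weight_integral (\<lambda>x. x ^ n *\<^sub>R F x) W G $ a $ b) sums
    weight_integral (\<lambda>x. (1 / (1 - s * x)) *\<^sub>R F x) W G $ a $ b"
proof -
  have "(\<lambda>n. \<Sum>k\<in>UNIV. \<Sum>l\<in>UNIV. complex_of_real (s ^ n) *
        cm_integral (\<lambda>E. W E $ k $ l) (\<lambda>x. x ^ n *\<^sub>R (F x $ a $ k * G x $ l $ b))) sums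
      (\<Sum>k\<in>UNIV. \<Sum>l\<in>UNIV.
        cm_integral (\<lambda>E. W E $ k $ l) (\<lambda>x. (1 / (1 - s * x)) *\<^sub>R (F x $ a $ k * G x $ l $ b)))"
    using int by (intro sums_sum cm_integral_geometric_sums s supp) (auto simp: weight_integrable_def)
  then show ?thesis
    by (simp add: weight_integral_def sum_distrib_left)
qed

text \<open>The expansion is a finite linear combination of the entries of \<open>X\<close>, so
  entrywise series pass through the trace.\<close>

lemma trace_unvec_matrix_mult:
  "trace (unvec ((M ** X) *v w)) =
    (\<Sum>a\<in>UNIV. \<Sum>p\<in>UNIV. \<Sum>q\<in>UNIV. M $ (a, a) $ p * w $ q * X $ p $ q)"
  unfolding matrix_vector_mul_assoc[symmetric]
  by (simp add: trace_def unvec_def matrix_vector_mult_def sum_distrib_left mult_ac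
      del: matrix_vector_mul_assoc)

lemma trace_unvec_sums:
  assumes "\<And>p q. (\<lambda>n. c n * X n $ p $ q) sums Y $ p $ q"
  shows "(\<lambda>n. c n * trace (unvec ((M ** X n) *v w))) sums trace (unvec ((M ** Y) *v w))"
proof -
  have "(\<lambda>n. \<Sum>a\<in>UNIV. \<Sum>p\<in>UNIV. \<Sum>q\<in>UNIV. M $ (a, a) $ p * w $ q * (c n * X n $ p $ q))
      sums trace (unvec ((M ** Y) *v w))"
    unfolding trace_unvec_matrix_mult by (intro sums_sum sums_mult assms)
  then show ?thesis
    by (simp add: trace_unvec_matrix_mult sum_distrib_left mult_ac)
qed

lemma stieltjes_transform_eq_weight_integral:
  assumes Q: "\<And>x. Q x = mat 1" and z: "1 < z"
  shows "stieltjes_transform (complex_of_real z) W $ a $ b =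
    (1 / z) *\<^sub>R weight_integral (\<lambda>x. (1 / (1 - 1 / z * x)) *\<^sub>R adj (Q x)) W Q $ a $ b"
proof -
  have "1 / (complex_of_real z - complex_of_real x) =
      (1 / z) *\<^sub>R complex_of_real (1 / (1 - 1 / z * x))" for x
  proof -
    \<comment> \<open>At \<open>x = z\<close> both sides are 0 because division by 0 gives
      0.\<close>
    have "1 / (z - x) = 1 / z * (1 / (1 - 1 / z * x))"
      using z by (cases "x = z") (auto simp: field_simps)
    then show ?thesis
      by (metis of_real_1 of_real_diff of_real_divide of_real_mult scaleR_conv_of_real)
  qed
  then show ?thesis
    by (simp only: weight_integral_Q_0[OF Q] stieltjes_transform_def vec_lambda_beta cm_integral_scaleR)
qed

text \<open>At vertex 0, where \<open>Q 0\<close> is the identity, multiplying \<open>P n\<close> by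
  the inverse of \<open>norm_matrix W Q 0\<close> returns the \<open>n\<close>-th moment matrix of
  \<open>W\<close>, so bounded powers mean bounded moments.\<close>

lemma weight_matrix_support_of_bounded_powers:
  assumes W: "weight_matrix W" and Q0: "\<And>x. Q 0 x = mat 1"
    and int: "\<And>n. weight_integrable (\<lambda>x. x ^ n *\<^sub>R adj (Q 0 x)) W (Q 0)"
    and inv: "invertible (weight_integral (\<lambda>x. adj (Q 0 x)) W (Q 0))"
    and P: "\<And>n. P n = norm_matrix W Q 0 ** weight_integral (\<lambda>x. x ^ n *\<^sub>R adj (Q 0 x)) W (Q 0)"
    and bound: "\<And>n p q. norm (P n $ p $ q) \<le> K"
    and E: "E \<in> sets borel" "E \<inter> {-1..1} = {}"
  shows "W E $ k $ l = 0"
proof -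
  define S where "S = weight_integral (\<lambda>x. adj (Q 0 x)) W (Q 0)"
  define C where "C = (\<Sum>p\<in>UNIV. \<Sum>r\<in>UNIV. norm (S $ p $ r) * K)"
  have K: "0 \<le> K"
    using bound[of 0 undefined undefined] norm_ge_zero order_trans by blast
  have "S ** P n = weight_integral (\<lambda>x. x ^ n *\<^sub>R adj (Q 0 x)) W (Q 0)" for n
    using someI_ex[OF inv[unfolded invertible_def]]
    by (simp add: P norm_matrix_def matrix_inv_def S_def matrix_mul_assoc)
  then have moment: "cm_integral (\<lambda>E. W E $ p $ p) (\<lambda>x. complex_of_real (x ^ n)) = (S ** P n) $ p $ p" for p n
    by (simp only: weight_integral_Q_0[of "Q 0", OF Q0])
  show ?thesis
  proof (rule weight_matrix_support[OF W _ _ E])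
    fix p n
    have "cm_integrable (\<lambda>E. W E $ p $ p)
        (\<lambda>x. (x ^ n *\<^sub>R adj (Q 0 x)) $ p $ p * Q 0 x $ p $ p)"
      using int unfolding weight_integrable_def by blast
    then show "cm_integrable (\<lambda>E. W E $ p $ p) (\<lambda>x. complex_of_real (x ^ n))"
      by (simp add: Q0 adj_def mat_def scaleR_conv_of_real[where 'a=complex])
    have "norm ((S ** P n) $ p $ p) \<le> (\<Sum>r\<in>UNIV. norm (S $ p $ r) * K)"
      unfolding matrix_matrix_mult_def vec_lambda_beta
      by (rule sum_norm_le) (simp add: norm_mult mult_left_mono bound)
    also have "\<dots> \<le> C"
      unfolding C_def using K
      by (intro member_le_sum[where f="\<lambda>p. \<Sum>r\<in>UNIV. norm (S $ p $ r) * K"]) (auto intro!: sum_nonneg)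
    finally show "norm (cm_integral (\<lambda>E. W E $ p $ p) (\<lambda>x. complex_of_real (x ^ n))) \<le> C"
      by (simp only: moment)
  qed
qed

text \<open>The integral formula at vertex 0 carries the factor \<open>norm_matrix W Q 0\<close>,
  the inverse of the integral of \<open>dW\<close>. The Stieltjes criterion is therefore given with
  this factor, and without it under the normalisation that it is the identity.\<close>

theorem theorem4p1:
  fixes \<Phi> :: "nat \<Rightarrow> nat \<Rightarrow> 'n::finite cmat \<Rightarrow> 'n cmat"
    and A B C :: "nat \<Rightarrow> ('n \<times> 'n) cmat"
    and Q :: "nat \<Rightarrow> real \<Rightarrow> ('n \<times> 'n) cmat"
    and W :: "real set \<Rightarrow> ('n \<times> 'n) cmat"
    and \<rho> :: "'n cmat"
  assumes "quantum_markov_chain \<Phi>"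
    and "\<And>n. matrix_rep (\<Phi> (Suc n) n) = A n"
    and "\<And>n. matrix_rep (\<Phi> n n) = B n"
    and "\<And>n. matrix_rep (\<Phi> n (Suc n)) = C (Suc n)"
    and "\<And>i j. Suc j < i \<or> Suc i < j \<Longrightarrow> matrix_rep (\<Phi> i j) = 0"
    and "\<And>n. invertible (A n)"
    and "associated_polynomials A B C Q"
    and "weight_matrix W"
    and "\<And>i j n. weight_integrable (\<lambda>x. x ^ n *\<^sub>R adj (Q i x)) W (Q j)"
    and "\<And>i. invertible (weight_integral (\<lambda>x. adj (Q i x)) W (Q i))"
    and "\<And>i j n. qmc_power \<Phi> n i j =
           norm_matrix W Q i ** weight_integral (\<lambda>x. x ^ n *\<^sub>R adj (Q i x)) W (Q j)"
    and "density_matrix \<rho>"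
  shows "(\<forall>i. rho_recurrent \<Phi> \<rho> i \<longleftrightarrow>
            tends_to_infinity
              (\<lambda>s. trace (unvec ((norm_matrix W Q i **
                 weight_integral (\<lambda>x. (1 / (1 - s * x)) *\<^sub>R adj (Q i x)) W (Q i)) *v mvec \<rho>)))
              (at_left (1::real))) \<and>
         (rho_recurrent \<Phi> \<rho> 0 \<longleftrightarrow>
            tends_to_infinity
              (\<lambda>z. trace (unvec ((norm_matrix W Q 0 **
                 stieltjes_transform (complex_of_real z) W) *v mvec \<rho>)))
              (at_right 1)) \<and>
         (norm_matrix W Q 0 = mat 1 \<longrightarrow>
            (rho_recurrent \<Phi> \<rho> 0 \<longleftrightarrow>
              tends_to_infinity
                (\<lambda>z. trace (unvec (stieltjes_transform (complex_of_real z) W *v mvec \<rho>)))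
                (at_right 1)))"
proof -
  note \<Phi> = assms(1) and tridiagonal = assms(5) and int = assms(9) and power = assms(11)
  have psd: "psd \<rho>"
    using assms(12) by (simp add: density_matrix_def)
  have Q0: "Q 0 x = mat 1" for x
    using assms(7) by (simp add: associated_polynomials_def)
  have supp: "W E $ k $ l = 0" if "E \<in> sets borel" "E \<inter> {-1..1} = {}" for E k l
    by (rule weight_matrix_support_of_bounded_powers[OF assms(8) Q0 int assms(10) power
          qmc_power_entry_bound[OF \<Phi> tridiagonal] that])
  define f where "f i s = trace (unvec ((norm_matrix W Q i **
      weight_integral (\<lambda>x. (1 / (1 - s * x)) *\<^sub>R adj (Q i x)) W (Q i)) *v mvec \<rho>))" for i and s :: real
  let ?p = "\<lambda>i. transition_prob \<Phi> \<rho> i i"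
  have psd_power: "psd (unvec (qmc_power \<Phi> n i i *v mvec \<rho>))" for n i
    by (rule qmc_power_psd[OF \<Phi> tridiagonal psd])
  have nonneg: "0 \<le> ?p i n" for i n
    unfolding transition_prob_def by (rule psd_trace[OF psd_power])
  have f_sums: "(\<lambda>n. complex_of_real (?p i n * s ^ n)) sums f i s" if s: "0 < s" "s < 1" for i s
  proof -
    \<comment> \<open>The instance \<open>n = 0\<close> of the integrability assumption is the
      integrand without a power of \<open>x\<close>, from which the series is built.\<close>
    have "(\<lambda>n. complex_of_real (s ^ n) * trace (unvec (qmc_power \<Phi> n i i *v mvec \<rho>))) sums f i s"
      unfolding f_def power
      using int[of 0 i i] s by (intro trace_unvec_sums weight_integral_geometric_sums supp) auto
    \<comment> \<open>By positivity the trace is already real, so the real part in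
      \<open>transition_prob\<close> loses nothing.\<close>
    moreover have "trace (unvec (qmc_power \<Phi> n i i *v mvec \<rho>)) = complex_of_real (?p i n)" for n
      using psd_trace(2)[OF psd_power] by (simp add: transition_prob_def complex_eq_iff)
    ultimately show ?thesis
      by (simp add: mult.commute)
  qed
  have Re_f: "(\<lambda>n. ?p i n * s ^ n) sums Re (f i s)" if "0 < s" "s < 1" for i s
    using sums_Re[OF f_sums[OF that]] by simp
  have f_real: "f i s \<in> \<real>" if "0 < s" "s < 1" for i s
    using sums_Im[OF f_sums[OF that, of i]] by (simp add: complex_is_Real_iff sums_iff)
  have Re_f_nonneg: "0 \<le> Re (f i s)" if "0 < s" "s < 1" for i s
    by (rule sums_le[OF _ sums_zero Re_f[OF that]]) (use nonneg that in simp)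
  have filterlim_iff: "filterlim (\<lambda>s. Re (f i s)) at_top (at_left 1) \<longleftrightarrow> rho_recurrent \<Phi> \<rho> i" for i
    unfolding rho_recurrent_def by (rule Abel_at_top_iff[OF nonneg Re_f])
  have recurrent_iff: "rho_recurrent \<Phi> \<rho> i \<longleftrightarrow> tends_to_infinity (f i) (at_left 1)" for i
  proof -
    have "\<forall>\<^sub>F s in at_left 1. f i s \<in> \<real>"
      using eventually_at_left_real[of 0 1] by (auto elim!: eventually_mono intro: f_real)
    then show ?thesis
      by (simp add: tends_to_infinity_def filterlim_iff)
  qed
  define g where "g z = trace (unvec ((norm_matrix W Q 0 **
      stieltjes_transform (complex_of_real z) W) *v mvec \<rho>))" for z
  have g: "g z = f 0 (1 / z) / z" if "1 < z" for z
    using stieltjes_transform_eq_weight_integral[of "Q 0", OF Q0 that]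
    by (simp add: g_def f_def trace_unvec_matrix_mult sum_divide_distrib scaleR_conv_of_real)
  have ev: "\<forall>\<^sub>F z in at_right (1::real). 1 < z"
    by (simp add: eventually_at_filter)
  have "filterlim (\<lambda>z. Re (g z)) at_top (at_right 1) \<longleftrightarrow>
      filterlim (\<lambda>z. Re (f 0 (1 / z)) / z) at_top (at_right 1)"
    using ev by (intro filterlim_cong refl) (auto elim!: eventually_mono simp: g)
  also have "\<dots> \<longleftrightarrow> rho_recurrent \<Phi> \<rho> 0"
    using filterlim_at_top_inverse_argument_iff[of "\<lambda>s. Re (f 0 s)"] Re_f_nonneg filterlim_iff
    by simp
  finally have "filterlim (\<lambda>z. Re (g z)) at_top (at_right 1) \<longleftrightarrow> rho_recurrent \<Phi> \<rho> 0" .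
  moreover have "\<forall>\<^sub>F z in at_right 1. g z \<in> \<real>"
    using ev by (auto elim!: eventually_mono simp: g intro!: Reals_divide f_real)
  ultimately have stieltjes_iff: "rho_recurrent \<Phi> \<rho> 0 \<longleftrightarrow> tends_to_infinity g (at_right 1)"
    by (simp add: tends_to_infinity_def)
  show ?thesis
    using recurrent_iff stieltjes_iff unfolding f_def g_def by auto
qed

end
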